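(* Let $X$ be a real locally convex Hausdorff topological vector space and let $\emptyset\neq\mathscr V\subset X^*\times\mathbb R$ be such that $\mathcal F:=\{x\in X:\langle x^*,x\rangle\le r\ \forall(x^*,r)\in\mathscr V\}\ne\emptyset$. The following statements are equivalent: (i) For all $(c,s)\in X^*\times\mathbb R$ such that $\inf_{x\in\mathcal F}\langle c,x\rangle>-\infty$, the next two assertions are equivalent: $\quad(\alpha)$ for every $x\in X$: $\ \big[\langle x^*,x\rangle\le r\ \ \forall(x^*,r)\in\mathscr V\big]\Longrightarrow\langle c,x\rangle\ge s$; $\quad(\beta)$ there exist $(\bar x^*,\bar r)\in\mathscr V$ and $\bar\lambda\ge0$ such that $\bar\lambda\bar x^*=-c$ and $\bar\lambda\bar r\le -s$. (ii) $\operatorname{cone}\mathscr V+\mathbb R_+(0_{X^*},1)$ is a convex and closed subset of $X^*\times\mathbb R$.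
   Context: $X^*$ is the topological dual of $X$ with the weak* topology; $X^*\times\mathbb R$ has the product topology. $\operatorname{cone}B=\{\lambda b:\lambda\ge0,b\in B\}$. *)

theory Defs
  imports "HOL-Analysis.Analysis"
begin

class real_topological_vector = real_vector + topological_ab_group_add +
  assumes tendsto_scaleR_Pair:
    "LIM p (nhds a \<times>\<^sub>F nhds x). fst p *\<^sub>R snd p :> nhds (a *\<^sub>R x)"

(* The conjunct on C is the library's convex C; that constant has sort real_vector and cannot
   be used inside a class specification (see locally_convex_nhds_0 below). *)
class locally_convex_t2_space = real_topological_vector + t2_space +
  assumes nhds_0_convex_base:
    "open U \<Longrightarrow> 0 \<in> U \<Longrightarrow> \<exists>C. open C \<and> 0 \<in> C \<and> C \<subseteq> U \<and>
       (\<forall>x\<in>C. \<forall>y\<in>C. \<forall>u\<ge>0. \<forall>v\<ge>0. u + v = 1 \<longrightarrow> u *\<^sub>R x + v *\<^sub>R y \<in> C)"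

lemma locally_convex_nhds_0:
  fixes U :: "'a::locally_convex_t2_space set"
  assumes "open U" "0 \<in> U"
  shows "\<exists>C. open C \<and> convex C \<and> 0 \<in> C \<and> C \<subseteq> U"
  using nhds_0_convex_base[OF assms] unfolding convex_def by blast

instance real_normed_vector \<subseteq> locally_convex_t2_space
proof
  fix a :: real and x :: 'a
  show "LIM p (nhds a \<times>\<^sub>F nhds x). fst p *\<^sub>R snd p :> nhds (a *\<^sub>R x)"
    by (intro tendsto_scaleR filterlim_fst filterlim_snd)
next
  fix U :: "'a set"
  assume "open U" "0 \<in> U"
  then obtain e where "e > 0" "ball 0 e \<subseteq> U"
    by (auto simp: open_contains_ball)
  then show "\<exists>C. open C \<and> 0 \<in> C \<and> C \<subseteq> U \<and>
      (\<forall>x\<in>C. \<forall>y\<in>C. \<forall>u\<ge>0. \<forall>v\<ge>0. u + v = 1 \<longrightarrow> u *\<^sub>R x + v *\<^sub>R y \<in> C)"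
    using convex_ball[of 0 e] unfolding convex_def
    by (intro exI[of _ "ball 0 e"]) (simp only: open_ball, simp)
qed

typedef (overloaded) 'a tdual =
    "{f :: 'a::{real_vector, topological_space} \<Rightarrow> real. linear f \<and> continuous_on UNIV f}"
  morphisms pairing Abs_tdual
  by (rule exI[of _ "\<lambda>_. 0"]) (auto simp: linear_iff)

setup_lifting type_definition_tdual

instantiation tdual :: ("{real_vector, topological_space}") real_vector
begin

lift_definition zero_tdual :: "'a tdual" is "\<lambda>_. 0"
  by (auto simp: linear_iff)

lift_definition plus_tdual :: "'a tdual \<Rightarrow> 'a tdual \<Rightarrow> 'a tdual" is "\<lambda>f g x. f x + g x"
  by (auto simp: linear_iff algebra_simps intro!: continuous_intros)

lift_definition minus_tdual :: "'a tdual \<Rightarrow> 'a tdual \<Rightarrow> 'a tdual" is "\<lambda>f g x. f x - g x"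
  by (auto simp: linear_iff algebra_simps intro!: continuous_intros)

lift_definition uminus_tdual :: "'a tdual \<Rightarrow> 'a tdual" is "\<lambda>f x. - f x"
  by (auto simp: linear_iff algebra_simps intro!: continuous_intros)

lift_definition scaleR_tdual :: "real \<Rightarrow> 'a tdual \<Rightarrow> 'a tdual" is "\<lambda>a f x. a * f x"
  by (auto simp: linear_iff algebra_simps intro!: continuous_intros)

instance
  by standard (transfer; simp add: algebra_simps fun_eq_iff)+

end

text \<open>
  The topology on the dual is the weak* topology: the coarsest one for which all evaluations
  \<open>\<lambda>f. pairing f x\<close> are continuous. For normed \<open>'a\<close> this is not the operator norm topology
  of \<open>'a \<Rightarrow>\<^sub>L real\<close>. On \<open>'a tdual \<times> real\<close> the library then provides the product topology.
\<close>

instantiation tdual :: ("{real_vector, topological_space}") topological_space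
begin

definition open_tdual :: "'a tdual set \<Rightarrow> bool" where
  "open_tdual = generate_topology {(\<lambda>f. pairing f x) -` U | x U. open U}"

instance
  by (intro_classes; unfold open_tdual_def; auto intro: generate_topology.intros)

end

text \<open>The library predicate \<^const>\<open>cone\<close> recognises cones; this is the cone generated by a set.\<close>

definition cone_gen :: "'a::real_vector set \<Rightarrow> 'a set" where
  "cone_gen B = {l *\<^sub>R b | l b. 0 \<le> l \<and> b \<in> B}"

definition feasible_set :: "('a::{real_vector, topological_space} tdual \<times> real) set \<Rightarrow> 'a set" where
  "feasible_set V = {x. \<forall>(f, r)\<in>V. pairing f x \<le> r}"

end

theory Submission
  imports Defs
begin

text \<open>
  Write \<open>K = cone V + \<real>\<^sub>+(0, 1)\<close> and let \<open>P\<close> be the set of all \<open>(g, t)\<close> with \<open>g \<le> t\<close> on the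
  feasible set. Up to signs, (\<open>\<beta>\<close>) says that \<open>(-c, -s) \<in> K\<close> and (\<open>\<alpha>\<close>) that \<open>(-c, -s) \<in> P\<close>, and
  (\<open>\<alpha>\<close>) bounds the infimum by itself, so (i) means \<open>K = P\<close>. The set \<open>P\<close> is an
  intersection of weak* closed half-spaces. Conversely, if the cone \<open>K\<close> is convex and closed, a
  point outside \<open>K\<close> has a neighbourhood avoiding \<open>K\<close> that depends on finitely many evaluations
  only, so a nearest-point argument in finitely many coordinates strictly separates it from \<open>K\<close> by
  some \<open>(g, t) \<mapsto> g x + b t\<close> with \<open>b \<le> 0\<close>. If \<open>b < 0\<close>, then \<open>- x / b\<close> is a feasible point showing
  that the given point is not in \<open>P\<close>; if \<open>b = 0\<close>, then \<open>x\<close> is a recession direction of the feasible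
  set along which \<open>g\<close> is unbounded.
\<close>

section \<open>Nearest-point separation from a convex cone in finitely many coordinates\<close>

text \<open>First-order optimality condition: after division by \<open>t\<close>, the linear
  coefficient dominates as \<open>t\<close> tends to 0.\<close>

lemma nonneg_if_quadratic_nonneg:
  fixes a b :: real
  assumes "\<And>t. 0 < t \<Longrightarrow> t \<le> 1 \<Longrightarrow> 0 \<le> 2 * t * a + t\<^sup>2 * b"
  shows "0 \<le> a"
proof (rule ccontr)
  assume "\<not> 0 \<le> a"
  \<comment> \<open>This step size makes \<open>t * b\<close> at most \<open>- a\<close>, so that
    \<open>2 * a + t * b\<close> is at most \<open>a < 0\<close>.\<close>
  define t where "t = min 1 (- a / (\<bar>b\<bar> + 1))"
  have t: "0 < t" "t \<le> 1" "t \<le> - a / (\<bar>b\<bar> + 1)"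
    using \<open>\<not> 0 \<le> a\<close> by (auto simp: t_def intro!: divide_neg_pos)
  have "t * (\<bar>b\<bar> + 1) \<le> - a"
    using t(3) by (subst (asm) pos_le_divide_eq) auto
  have "0 \<le> t * (2 * a + t * b)"
    using assms[OF t(1,2)] by (simp add: power2_eq_square algebra_simps)
  then have "0 \<le> 2 * a + t * b"
    using t(1) by (simp add: zero_le_mult_iff)
  moreover have "t * b \<le> t * (\<bar>b\<bar> + 1)"
    using t(1) by (intro mult_left_mono) auto
  ultimately show False
    using \<open>t * (\<bar>b\<bar> + 1) \<le> - a\<close> \<open>\<not> 0 \<le> a\<close> by linarith
qed

text \<open>The bound is the one the parallelogram law yields for a minimizing sequence whose n-th
  error is below \<open>1 / (n + 1)\<close>.\<close>

lemma Cauchy_power2_bound: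
  fixes z :: "nat \<Rightarrow> real"
  assumes "\<And>m n. (z m - z n)\<^sup>2 \<le> 2 / (real m + 1) + 2 / (real n + 1)"
  shows "Cauchy z"
proof (rule metric_CauchyI)
  fix e :: real
  assume "0 < e"
  obtain N where N: "4 / e\<^sup>2 < real N"
    using reals_Archimedean2 by blast
  have *: "2 / (real n + 1) < e\<^sup>2 / 2" if "N \<le> n" for n
  proof -
    have "4 / e\<^sup>2 < real n + 1"
      using N that by linarith
    then show ?thesis
      using \<open>0 < e\<close> by (simp add: field_simps)
  qed
  have "dist (z m) (z n) < e" if "N \<le> m" "N \<le> n" for m n
  proof -
    have "\<bar>z m - z n\<bar>\<^sup>2 < e\<^sup>2"
      using assms[of m n] *[OF that(1)] *[OF that(2)] by simp
    then show ?thesis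
      using \<open>0 < e\<close> by (simp add: dist_real_def power2_less_imp_less)
  qed
  then show "\<exists>N. \<forall>m\<ge>N. \<forall>n\<ge>N. dist (z m) (z n) < e"
    by blast
qed

text \<open>
  The functionals \<open>L i\<close> play the role of coordinates; the number of them is not fixed by a type, so
  the separation theorems for Euclidean spaces do not apply.
\<close>

lemma convex_cone_separation_finite:
  fixes K :: "'b::real_vector set" and L :: "'i \<Rightarrow> 'b \<Rightarrow> real"
  assumes fin: "finite I" and lin: "\<And>i. i \<in> I \<Longrightarrow> linear (L i)"
    and K: "convex K" "cone K" "K \<noteq> {}"
    and e: "0 < e" and far: "\<And>k. k \<in> K \<Longrightarrow> \<exists>i\<in>I. e \<le> \<bar>L i k - L i p\<bar>"
  obtains a where "\<And>k. k \<in> K \<Longrightarrow> (\<Sum>i\<in>I. a i * L i k) \<le> 0" "0 < (\<Sum>i\<in>I. a i * L i p)"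
proof -
  \<comment> \<open>\<open>q k\<close> is the squared Euclidean distance from \<open>p\<close> to
    \<open>k\<close> in coordinates; \<open>D\<close> is its infimum over \<open>K\<close>.\<close>
  define q where "q k = (\<Sum>i\<in>I. (L i p - L i k)\<^sup>2)" for k
  define D where "D = (INF k\<in>K. q k)"
  have q_lower: "e\<^sup>2 \<le> q k" if k: "k \<in> K" for k
  proof -
    obtain i where i: "i \<in> I" "e \<le> \<bar>L i k - L i p\<bar>"
      using far[OF k] by blast
    have "e\<^sup>2 \<le> \<bar>L i k - L i p\<bar>\<^sup>2"
      using i e by (intro power_mono) auto
    also have "\<dots> = (L i p - L i k)\<^sup>2"
      by (simp add: power2_commute)
    also have "\<dots> \<le> q k"
      unfolding q_def using i fin by (intro member_le_sum) auto
    finally show ?thesis .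
  qed
  have bdd: "bdd_below (q ` K)"
    using q_lower by (auto intro!: bdd_belowI)
  have D_le: "D \<le> q k" if "k \<in> K" for k
    unfolding D_def using bdd that by (rule cINF_lower)
  have D_pos: "0 < D"
  proof -
    have "e\<^sup>2 \<le> D"
      unfolding D_def using K(3) q_lower by (rule cINF_greatest)
    with e show ?thesis
      by (meson less_le_trans zero_less_power)
  qed
  have "\<exists>k\<in>K. q k < D + 1 / (real n + 1)" for n
  proof -
    have "(INF k\<in>K. q k) < D + 1 / (real n + 1)"
      by (simp add: D_def)
    then show ?thesis
      by (simp add: cINF_less_iff[OF K(3) bdd])
  qed
  then obtain k where kK: "\<And>n. k n \<in> K" and kq: "\<And>n. q (k n) < D + 1 / (real n + 1)"
    by metis
  have parallelogram: "(\<Sum>i\<in>I. (L i (k m) - L i (k n))\<^sup>2) \<le> 2 / (real m + 1) + 2 / (real n + 1)" for m n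
  proof -
    \<comment> \<open>The midpoint stays in \<open>K\<close> by convexity, so \<open>q h\<close> is
      at least \<open>D\<close>, which cancels the \<open>4 * D\<close> from the two
      near-minimizers.\<close>
    define h where "h = (1/2) *\<^sub>R k m + (1/2) *\<^sub>R k n"
    have "h \<in> K"
      unfolding h_def using convexD[OF K(1) kK kK] by simp
    have "(\<Sum>i\<in>I. (L i (k m) - L i (k n))\<^sup>2) = 2 * q (k m) + 2 * q (k n) - 4 * q h"
      unfolding q_def sum_distrib_left sum.distrib[symmetric] sum_subtractf[symmetric]
      by (intro sum.cong refl)
        (simp add: h_def linear_add[OF lin] linear_scale[OF lin] power2_eq_square field_simps)
    then show ?thesis
      using D_le[OF \<open>h \<in> K\<close>] kq[of m] kq[of n] by linarith
  qed
  have "\<exists>y. (\<lambda>n. L i (k n)) \<longlonglongrightarrow> y" if i: "i \<in> I" for i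
  proof -
    have "(L i (k m) - L i (k n))\<^sup>2 \<le> (\<Sum>i\<in>I. (L i (k m) - L i (k n))\<^sup>2)" for m n
      using fin i by (intro member_le_sum) auto
    then have "Cauchy (\<lambda>n. L i (k n))"
      by (intro Cauchy_power2_bound order_trans[OF _ parallelogram])
    then show ?thesis
      using convergent_eq_Cauchy by blast
  qed
  then obtain y where y: "\<And>i. i \<in> I \<Longrightarrow> (\<lambda>n. L i (k n)) \<longlonglongrightarrow> y i"
    by metis
  \<comment> \<open>The limit \<open>y\<close> is the nearest point in coordinates only; it is not
    claimed to come from an element of \<open>K\<close>. The residual \<open>a\<close> is the normal
    of the separating hyperplane.\<close>
  define a where "a i = L i p - y i" for i
  \<comment> \<open>The convex cone contains \<open>s *\<^sub>R k n + t *\<^sub>R k'\<close>, and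
    the distance bound survives the limit in \<open>n\<close>.\<close>
  have lim_ge: "D \<le> (\<Sum>i\<in>I. (L i p - (s * y i + t * L i k'))\<^sup>2)"
    if k': "k' \<in> K" "0 \<le> s" "0 \<le> t" for k' s t
  proof (rule LIMSEQ_le_const)
    show "(\<lambda>n. \<Sum>i\<in>I. (L i p - (s * L i (k n) + t * L i k'))\<^sup>2)
        \<longlonglongrightarrow> (\<Sum>i\<in>I. (L i p - (s * y i + t * L i k'))\<^sup>2)"
      by (intro tendsto_intros y)
    have "D \<le> (\<Sum>i\<in>I. (L i p - (s * L i (k n) + t * L i k'))\<^sup>2)" for n
    proof -
      have "s *\<^sub>R k n + t *\<^sub>R k' \<in> K"
        using K(1,2) k' by (intro convex_cone[THEN iffD1, THEN conjunct1, rule_format] mem_cone kK) auto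
      then have "D \<le> q (s *\<^sub>R k n + t *\<^sub>R k')"
        by (rule D_le)
      also have "\<dots> = (\<Sum>i\<in>I. (L i p - (s * L i (k n) + t * L i k'))\<^sup>2)"
        unfolding q_def
        by (intro sum.cong refl) (simp add: linear_add[OF lin] linear_scale[OF lin])
      finally show ?thesis .
    qed
    then show "\<exists>N. \<forall>n\<ge>N. D \<le> (\<Sum>i\<in>I. (L i p - (s * L i (k n) + t * L i k'))\<^sup>2)"
      by blast
  qed
  have lim_le: "(\<Sum>i\<in>I. (a i)\<^sup>2) \<le> D"
  proof (rule LIMSEQ_le)
    show "(\<lambda>n. q (k n)) \<longlonglongrightarrow> (\<Sum>i\<in>I. (a i)\<^sup>2)"
      unfolding q_def a_def by (intro tendsto_intros y)
    show "(\<lambda>n. D + 1 / (real n + 1)) \<longlonglongrightarrow> D"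
      using tendsto_add[OF tendsto_const LIMSEQ_inverse_real_of_nat, of D]
      by (simp add: inverse_eq_divide add.commute)
    show "\<exists>N. \<forall>n\<ge>N. q (k n) \<le> D + 1 / (real n + 1)"
      using kq less_imp_le by blast
  qed
  have variation: "0 \<le> (\<Sum>i\<in>I. a i * w i)"
    if w: "\<And>t. 0 < t \<Longrightarrow> t \<le> 1 \<Longrightarrow> D \<le> (\<Sum>i\<in>I. (a i + t * w i)\<^sup>2)" for w
  proof (rule nonneg_if_quadratic_nonneg)
    fix t :: real
    assume "0 < t" "t \<le> 1"
    have "(\<Sum>i\<in>I. (a i + t * w i)\<^sup>2) =
        (\<Sum>i\<in>I. (a i)\<^sup>2) + 2 * t * (\<Sum>i\<in>I. a i * w i) + t\<^sup>2 * (\<Sum>i\<in>I. (w i)\<^sup>2)"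
      unfolding sum_distrib_left sum.distrib[symmetric]
      by (intro sum.cong refl) (simp add: power2_eq_square algebra_simps)
    then show "0 \<le> 2 * t * (\<Sum>i\<in>I. a i * w i) + t\<^sup>2 * (\<Sum>i\<in>I. (w i)\<^sup>2)"
      using w[OF \<open>0 < t\<close> \<open>t \<le> 1\<close>] lim_le by linarith
  qed
  have "(\<Sum>i\<in>I. a i * L i k') \<le> 0" if k': "k' \<in> K" for k'
  proof -
    \<comment> \<open>Moving from \<open>y\<close> by \<open>t\<close> times \<open>k'\<close> stays
      in the limit cone and cannot bring it closer to \<open>p\<close>.\<close>
    have "0 \<le> (\<Sum>i\<in>I. a i * (- L i k'))"
    proof (rule variation)
      fix t :: real
      assume "0 < t"
      then show "D \<le> (\<Sum>i\<in>I. (a i + t * (- L i k'))\<^sup>2)"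
        using lim_ge[OF k', of 1 t] by (simp add: a_def algebra_simps)
    qed
    then show ?thesis
      by (simp add: sum_negf)
  qed
  \<comment> \<open>Here \<open>y\<close> is shrunk to \<open>(1 - t) * y\<close>, whose factor is
    nonnegative because \<open>t \<le> 1\<close>. Hence the value at \<open>p\<close>, namely the
    squared norm of \<open>a\<close> plus this sum, is at least \<open>D\<close>.\<close>
  moreover have "0 \<le> (\<Sum>i\<in>I. a i * y i)"
  proof (rule variation)
    fix t :: real
    assume "0 < t" "t \<le> 1"
    then show "D \<le> (\<Sum>i\<in>I. (a i + t * y i)\<^sup>2)"
      using lim_ge[OF kK, of "1 - t" 0] by (simp add: a_def algebra_simps)
  qed
  moreover have "D \<le> (\<Sum>i\<in>I. (a i)\<^sup>2)"
    using lim_ge[OF kK, of 1 0] by (simp add: a_def)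
  moreover have "(\<Sum>i\<in>I. a i * L i p) = (\<Sum>i\<in>I. (a i)\<^sup>2) + (\<Sum>i\<in>I. a i * y i)"
    unfolding sum.distrib[symmetric]
    by (intro sum.cong refl) (simp add: a_def power2_eq_square algebra_simps)
  ultimately show ?thesis
    using that D_pos by fastforce
qed

section \<open>Weak* neighbourhoods and separation in the dual times the reals\<close>

lemma linear_pairing: "linear (pairing f)"
  using pairing[of f] by simp

lemma continuous_on_pairing [continuous_intros]:
  assumes "continuous_on S g"
  shows "continuous_on S (\<lambda>z. pairing (g z) x)"
proof -
  have "open ((\<lambda>f. pairing f x) -` U)" if "open U" for U
    unfolding open_tdual_def using that by (auto intro: generate_topology.Basis)
  then have "continuous_on UNIV (\<lambda>f. pairing f x)"
    by (simp add: continuous_on_open_vimage)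
  then show ?thesis
    using assms by (rule continuous_on_compose2) simp
qed

text \<open>Induction over the generated topology: a generator needs one evaluation point, and an
  intersection takes the union of the point sets and the smaller radius.\<close>

lemma open_tdual_basic_nhd:
  assumes "open W" "g \<in> W"
  obtains A e where "finite A" "0 < e" "\<And>h. (\<And>x. x \<in> A \<Longrightarrow> \<bar>pairing h x - pairing g x\<bar> < e) \<Longrightarrow> h \<in> W"
proof -
  have "generate_topology {(\<lambda>f. pairing f x) -` U | x U. open U} W"
    using assms(1) by (simp add: open_tdual_def)
  then have "\<exists>A e. finite A \<and> 0 < e \<and> (\<forall>h. (\<forall>x\<in>A. \<bar>pairing h x - pairing g x\<bar> < e) \<longrightarrow> h \<in> W)"
    using assms(2)
  proof induction
    case UNIV
    then show ?case
      by (auto intro!: exI[of _ "{}"] exI[of _ 1])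
  next
    case (Int S T)
    obtain A e where
      "finite A" "0 < e" "\<forall>h. (\<forall>x\<in>A. \<bar>pairing h x - pairing g x\<bar> < e) \<longrightarrow> h \<in> S"
      using Int by blast
    moreover obtain B d where
      "finite B" "0 < d" "\<forall>h. (\<forall>x\<in>B. \<bar>pairing h x - pairing g x\<bar> < d) \<longrightarrow> h \<in> T"
      using Int by blast
    ultimately show ?case
      by (intro exI[of _ "A \<union> B"] exI[of _ "min e d"]) simp
  next
    case (UN \<S>)
    then show ?case
      by (meson UnionE UnionI)
  next
    case (Basis S)
    then obtain x U where S: "S = (\<lambda>f. pairing f x) -` U" "open U"
      by blast
    then obtain e where "0 < e" "\<forall>y. dist y (pairing g x) < e \<longrightarrow> y \<in> U"
      using Basis.prems by (auto simp: open_dist)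
    then show ?case
      using S by (intro exI[of _ "{x}"] exI[of _ e]) (auto simp: dist_real_def)
  qed
  then show ?thesis
    by (elim exE conjE) (rule that, assumption+, simp)
qed

text \<open>A basic neighbourhood involves finitely many evaluations, and a linear combination of
  evaluations is evaluation at a single point. Hence the separating functional is given by an
  element of the primal space and a real.\<close>

lemma closed_convex_cone_separation_tdual:
  fixes K :: "('a::{real_vector, topological_space} tdual \<times> real) set"
  assumes K: "convex K" "cone K" "K \<noteq> {}" "closed K" and p: "(g, t) \<notin> K"
  obtains x b where "\<And>f r. (f, r) \<in> K \<Longrightarrow> pairing f x + b * r \<le> 0" "0 < pairing g x + b * t"
proof -
  have "open (- K)" "(g, t) \<in> - K"
    using K(4) p by auto
  then obtain W U where W: "open W" "g \<in> W" and U: "open U" "t \<in> U" and WU: "W \<times> U \<subseteq> - K"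
    by (rule open_prod_elim) auto
  obtain A d where A: "finite A" "0 < d"
      "\<And>h. (\<And>x. x \<in> A \<Longrightarrow> \<bar>pairing h x - pairing g x\<bar> < d) \<Longrightarrow> h \<in> W"
    using open_tdual_basic_nhd[OF W] by blast
  obtain e where e: "0 < e" "\<And>r. \<bar>r - t\<bar> < e \<Longrightarrow> r \<in> U"
    using U by (auto simp: open_dist dist_real_def)
  \<comment> \<open>\<open>None\<close> indexes the real coordinate, \<open>Some x\<close> the
    evaluation at \<open>x\<close>.\<close>
  define L where "L i q = (case i of None \<Rightarrow> snd q | Some x \<Rightarrow> pairing (fst q) x)"
    for i :: "'a option" and q :: "'a tdual \<times> real"
  define I where "I = insert None (Some ` A)"
  have lin: "linear (L i)" for i
    by (cases i) (auto simp: L_def linear_iff plus_tdual.rep_eq scaleR_tdual.rep_eq)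
  have far: "\<exists>i\<in>I. min d e \<le> \<bar>L i k - L i (g, t)\<bar>" if "k \<in> K" for k
  proof (rule ccontr)
    assume *: "\<not> ?thesis"
    have "fst k \<in> W"
      using * by (intro A(3)) (force simp: I_def L_def)
    moreover have "snd k \<in> U"
      using * by (intro e(2)) (force simp: I_def L_def)
    ultimately show False
      using WU that by (auto simp: mem_Times_iff)
  qed
  obtain a where a: "\<And>k. k \<in> K \<Longrightarrow> (\<Sum>i\<in>I. a i * L i k) \<le> 0" "0 < (\<Sum>i\<in>I. a i * L i (g, t))"
    using convex_cone_separation_finite[of I L K "min d e" "(g, t)"] K lin far A(1,2) e(1)
    by (auto simp: I_def)
  define x where "x = (\<Sum>x\<in>A. a (Some x) *\<^sub>R x)"
  have "(\<Sum>i\<in>I. a i * L i (f, r)) = pairing f x + a None * r" for f r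
    using A(1)
    by (simp add: I_def L_def x_def sum.reindex linear_sum[OF linear_pairing]
        linear_scale[OF linear_pairing])
  then show ?thesis
    using a that[of x "a None"] by metis
qed

section \<open>The cone generated by the constraints plus the vertical ray\<close>

text \<open>The ray absorbs the slack \<open>t - l * r\<close>, which brings membership into the
  form of (\<beta>).\<close>

lemma mem_cone_gen_plus_ray_iff:
  "(g, t) \<in> cone_gen V + {t *\<^sub>R (0, 1) | t. 0 \<le> t} \<longleftrightarrow>
    (\<exists>(f, r)\<in>V. \<exists>l\<ge>0. l *\<^sub>R f = g \<and> l * r \<le> (t::real))"
  (is "?lhs \<longleftrightarrow> ?rhs")
proof
  assume ?lhs
  then obtain q u where q: "q \<in> cone_gen V" and u: "u \<in> {t *\<^sub>R (0, 1) | t. 0 \<le> t}" and "(g, t) = q + u"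
    unfolding set_plus_def by blast
  moreover obtain l f r where "(f, r) \<in> V" "0 \<le> l" "q = l *\<^sub>R (f, r)"
    using q unfolding cone_gen_def by fast
  moreover obtain t' where "0 \<le> t'" "u = t' *\<^sub>R (0, 1)"
    using u by fast
  ultimately have "(f, r) \<in> V" "0 \<le> l" "0 \<le> t'" "(g, t) = l *\<^sub>R (f, r) + t' *\<^sub>R (0, 1)"
    by simp_all
  then have "(f, r) \<in> V" "0 \<le> l" "l *\<^sub>R f = g" "l * r \<le> t"
    by simp_all
  then show ?rhs
    by blast
next
  assume ?rhs
  then obtain f r l where *: "(f, r) \<in> V" "0 \<le> l" "l *\<^sub>R f = g" "l * r \<le> t"
    by blast
  have "l *\<^sub>R (f, r) \<in> cone_gen V"
    unfolding cone_gen_def using *(1,2) by blast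
  moreover have "(t - l * r) *\<^sub>R (0, 1) \<in> {t *\<^sub>R (0, 1) | t. 0 \<le> t}"
    by (intro CollectI exI[of _ "t - l * r"]) (simp add: *(4))
  ultimately have "l *\<^sub>R (f, r) + (t - l * r) *\<^sub>R (0, 1) \<in> cone_gen V + {t *\<^sub>R (0, 1) | t. 0 \<le> t}"
    by (rule set_plus_intro)
  then show ?lhs
    using * by simp
qed

lemma cone_cone_gen_plus_ray:
  "cone (cone_gen V + {t *\<^sub>R (0, 1::real) | t. 0 \<le> t})"
proof (unfold cone_def, intro ballI allI impI)
  fix q :: "'a \<times> real" and c :: real
  assume q: "q \<in> cone_gen V + {t *\<^sub>R (0, 1) | t. 0 \<le> t}" and "0 \<le> c"
  then obtain f r l where *: "(f, r) \<in> V" "0 \<le> l" "l *\<^sub>R f = fst q" "l * r \<le> snd q"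
    using mem_cone_gen_plus_ray_iff[of "fst q" "snd q" V] by auto
  have "0 \<le> c * l" "(c * l) *\<^sub>R f = c *\<^sub>R fst q" "(c * l) * r \<le> c * snd q"
    using * \<open>0 \<le> c\<close> by (simp_all add: mult.assoc mult_left_mono flip: *(3))
  then have "(c *\<^sub>R fst q, c * snd q) \<in> cone_gen V + {t *\<^sub>R (0, 1) | t. 0 \<le> t}"
    unfolding mem_cone_gen_plus_ray_iff using *(1) by blast
  then show "c *\<^sub>R q \<in> cone_gen V + {t *\<^sub>R (0, 1) | t. 0 \<le> t}"
    by (simp add: scaleR_prod_def)
qed

section \<open>Valid inequalities and their comparison with the cone\<close>

text \<open>This is the epigraph of the support function of \<open>F\<close>.\<close>

definition valid_inequalities ::
    "'a::{real_vector, topological_space} set \<Rightarrow> ('a tdual \<times> real) set" where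
  "valid_inequalities F = {(g, t). \<forall>x\<in>F. pairing g x \<le> t}"

lemma convex_valid_inequalities: "convex (valid_inequalities F)"
proof (rule convexI)
  fix p q :: "'a tdual \<times> real" and u v :: real
  assume "p \<in> valid_inequalities F" "q \<in> valid_inequalities F" "0 \<le> u" "0 \<le> v"
  then show "u *\<^sub>R p + v *\<^sub>R q \<in> valid_inequalities F"
    by (auto simp: valid_inequalities_def plus_tdual.rep_eq scaleR_tdual.rep_eq
        intro!: add_mono mult_left_mono)
qed

lemma closed_valid_inequalities: "closed (valid_inequalities F)"
proof -
  have "valid_inequalities F = (\<Inter>x\<in>F. {q. pairing (fst q) x \<le> snd q})"
    by (auto simp: valid_inequalities_def)
  also have "closed \<dots>"
    by (intro closed_INT ballI closed_Collect_le continuous_intros)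
  finally show ?thesis .
qed

lemma cone_gen_plus_ray_subset_valid:
  "cone_gen V + {t *\<^sub>R (0, 1) | t. 0 \<le> t} \<subseteq> valid_inequalities (feasible_set V)"
proof (clarify)
  fix g t
  assume "(g, t) \<in> cone_gen V + {t *\<^sub>R (0, 1) | t. 0 \<le> t}"
  then obtain f r l where *: "(f, r) \<in> V" "0 \<le> l" "l *\<^sub>R f = g" "l * r \<le> t"
    unfolding mem_cone_gen_plus_ray_iff by blast
  have "pairing g x \<le> t" if x: "x \<in> feasible_set V" for x
  proof -
    have "pairing g x = l * pairing f x"
      using *(3) by (auto simp: scaleR_tdual.rep_eq)
    also have "\<dots> \<le> l * r"
      using x *(1,2) by (auto simp: feasible_set_def intro!: mult_left_mono)
    finally show ?thesis
      using *(4) by simp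
  qed
  then show "(g, t) \<in> valid_inequalities (feasible_set V)"
    by (simp add: valid_inequalities_def)
qed

lemma valid_subset_cone_gen_plus_ray:
  fixes V :: "('a::{real_vector, topological_space} tdual \<times> real) set"
  defines "K \<equiv> cone_gen V + {t *\<^sub>R (0, 1) | t. 0 \<le> t}"
  assumes V: "V \<noteq> {}" and feasible: "feasible_set V \<noteq> {}" and K: "convex K" "closed K"
  shows "valid_inequalities (feasible_set V) \<subseteq> K"
proof (rule subrelI, rule ccontr)
  fix g t
  assume valid: "(g, t) \<in> valid_inequalities (feasible_set V)" and "(g, t) \<notin> K"
  have mem_K: "(f, r') \<in> K" if "(f, r) \<in> V" "r \<le> r'" for f r r'
    unfolding K_def mem_cone_gen_plus_ray_iff using that
    by (intro bexI[of _ "(f, r)"]) (auto intro!: exI[of _ 1])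
  then have "K \<noteq> {}"
    using V by fastforce
  have "cone K"
    unfolding K_def by (rule cone_cone_gen_plus_ray)
  obtain x b where sep: "\<And>f r. (f, r) \<in> K \<Longrightarrow> pairing f x + b * r \<le> 0" "0 < pairing g x + b * t"
    using closed_convex_cone_separation_tdual[OF K(1) \<open>cone K\<close> \<open>K \<noteq> {}\<close> K(2) \<open>(g, t) \<notin> K\<close>] by blast
  \<comment> \<open>The multiplier 0 on any element of \<open>V\<close> suffices; evaluating the
    separating functional at this point gives the sign of \<open>b\<close>.\<close>
  have "(0, 1) \<in> K"
    unfolding K_def mem_cone_gen_plus_ray_iff using V by (auto intro!: exI[of _ 0])
  then have "b \<le> 0"
    using sep(1) by (fastforce simp: zero_tdual.rep_eq)
  have sepV: "pairing f x + b * r \<le> 0" if "(f, r) \<in> V" for f r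
    using that by (intro sep(1) mem_K) auto
  show False
  proof (cases "b = 0")
    case True
    obtain x0 where x0: "x0 \<in> feasible_set V"
      using feasible by blast
    \<comment> \<open>The length is chosen so that \<open>g\<close> at
      \<open>x0 + l *\<^sub>R x\<close> is at least \<open>t + 1\<close>.\<close>
    define l where "l = (\<bar>t - pairing g x0\<bar> + 1) / pairing g x"
    have gx: "0 < pairing g x"
      using sep(2) True by simp
    then have "0 \<le> l" "l * pairing g x = \<bar>t - pairing g x0\<bar> + 1"
      by (auto simp: l_def)
    have "x0 + l *\<^sub>R x \<in> feasible_set V"
      unfolding feasible_set_def
    proof clarify
      fix f r
      assume fr: "(f, r) \<in> V"
      have "l * pairing f x \<le> 0"
        using sepV[OF fr] True \<open>0 \<le> l\<close> by (simp add: mult_nonneg_nonpos)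
      moreover have "pairing f x0 \<le> r"
        using fr x0 by (auto simp: feasible_set_def)
      ultimately show "pairing f (x0 + l *\<^sub>R x) \<le> r"
        by (simp add: linear_add[OF linear_pairing] linear_scale[OF linear_pairing])
    qed
    then have "pairing g (x0 + l *\<^sub>R x) \<le> t"
      using valid by (simp add: valid_inequalities_def)
    then show False
      using \<open>l * pairing g x = _\<close>
      by (simp add: linear_add[OF linear_pairing] linear_scale[OF linear_pairing])
  next
    case False
    \<comment> \<open>This scaling normalises the coefficient \<open>b\<close> to -1: the separating
      functional times \<open>l\<close> becomes \<open>pairing f (l *\<^sub>R x) - r\<close>, on
      \<open>V\<close> and at \<open>(g, t)\<close> alike.\<close>
    define l where "l = - 1 / b"
    have l: "0 < l" "l * b = - 1"
      using False \<open>b \<le> 0\<close> by (simp_all add: l_def divide_neg_neg)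
    have pairing_l: "pairing f (l *\<^sub>R x) = l * (pairing f x + b * r) + r" for f r
      using l(2) by (simp add: linear_scale[OF linear_pairing] distrib_left flip: mult.assoc)
    have "l *\<^sub>R x \<in> feasible_set V"
      unfolding feasible_set_def
    proof clarify
      fix f r
      assume "(f, r) \<in> V"
      then have "l * (pairing f x + b * r) \<le> 0"
        using sepV l(1) by (simp add: mult_nonneg_nonpos)
      then show "pairing f (l *\<^sub>R x) \<le> r"
        by (simp add: pairing_l[of f r])
    qed
    then have "pairing g (l *\<^sub>R x) \<le> t"
      using valid by (simp add: valid_inequalities_def)
    moreover have "0 < l * (pairing g x + b * t)"
      using l(1) sep(2) by (rule mult_pos_pos)
    ultimately show False
      by (simp add: pairing_l[of g t])
  qed
qed

section \<open>Both statements as the equality \<open>K = P\<close>\<close>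

theorem corollary5p1:
  fixes V :: "('a::locally_convex_t2_space tdual \<times> real) set"
  assumes "V \<noteq> {}"
    and "feasible_set V \<noteq> {}"
  shows
    "(\<forall>(c :: 'a tdual) (s :: real).
        (INF x\<in>feasible_set V. ereal (pairing c x)) > - \<infinity> \<longrightarrow>
        ((\<forall>x. (\<forall>(f, r)\<in>V. pairing f x \<le> r) \<longrightarrow> pairing c x \<ge> s) \<longleftrightarrow>
         (\<exists>(f, r)\<in>V. \<exists>l\<ge>0. l *\<^sub>R f = - c \<and> l * r \<le> - s)))
     \<longleftrightarrow>
     (convex (cone_gen V + {t *\<^sub>R (0, 1) | t. 0 \<le> t}) \<and>
      closed (cone_gen V + {t *\<^sub>R (0, 1) | t. 0 \<le> t}))"
proof -
  define K where "K = cone_gen V + {t *\<^sub>R (0, 1::real) | t. 0 \<le> t}"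
  define P where "P = valid_inequalities (feasible_set V)"
  have alpha: "(\<forall>x. (\<forall>(f, r)\<in>V. pairing f x \<le> r) \<longrightarrow> s \<le> pairing c x) \<longleftrightarrow> (- c, - s) \<in> P" for c s
    by (simp add: P_def valid_inequalities_def feasible_set_def uminus_tdual.rep_eq)
  have beta: "(\<exists>(f, r)\<in>V. \<exists>l\<ge>0. l *\<^sub>R f = - c \<and> l * r \<le> - s) \<longleftrightarrow> (- c, - s) \<in> K" for c s
    unfolding K_def mem_cone_gen_plus_ray_iff ..
  have inf: "(INF x\<in>feasible_set V. ereal (pairing c x)) > - \<infinity>" if "(- c, - s) \<in> P" for c s
  proof -
    have "ereal s \<le> (INF x\<in>feasible_set V. ereal (pairing c x))"
      using that by (intro INF_greatest) (simp add: P_def valid_inequalities_def uminus_tdual.rep_eq)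
    then show ?thesis
      using less_le_trans[of "- \<infinity>" "ereal s"] by simp
  qed
  have "K \<subseteq> P"
    unfolding K_def P_def by (rule cone_gen_plus_ray_subset_valid)
  have "(\<forall>c s. (INF x\<in>feasible_set V. ereal (pairing c x)) > - \<infinity> \<longrightarrow>
      ((- c, - s) \<in> P \<longleftrightarrow> (- c, - s) \<in> K)) \<longleftrightarrow> convex K \<and> closed K"
    (is "?i \<longleftrightarrow> _")
  proof
    assume i: ?i
    have "P \<subseteq> K"
    proof clarify
      fix g t
      assume "(g, t) \<in> P"
      then show "(g, t) \<in> K"
        \<comment> \<open>Every pair has the form \<open>(- c, - s)\<close>, and membership in
          \<open>P\<close> already supplies the finite-infimum hypothesis of (i).\<close>
        using i[rule_format, of "- g" "- t"] inf[of "- g" "- t"] by simp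
    qed
    with \<open>K \<subseteq> P\<close> have "K = P"
      by blast
    then show "convex K \<and> closed K"
      by (simp add: P_def convex_valid_inequalities closed_valid_inequalities)
  next
    assume "convex K \<and> closed K"
    then have "P \<subseteq> K"
      using valid_subset_cone_gen_plus_ray[OF assms] by (simp add: K_def P_def)
    with \<open>K \<subseteq> P\<close> have "K = P"
      by blast
    then show ?i
      by simp
  qed
  then show ?thesis
    unfolding alpha beta K_def .
qed

end
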